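(* Let $X$ be a topological space and let $P\in X$. Assume that $(X,P)$ is Fréchet–Urysohn at $P$, that $X$ is $T_1$ at $P$, that $P$ is non-isolated, and that there exists a function $f:X\to\mathbb{R}$ that is discontinuous at $P$. Let $\mathcal{F}$ be the family of all test sets at $P$, partially ordered by inclusion. Then there exist maximal chains $\mathcal{C}_{\mathrm{bad}},\mathcal{C}_{\mathrm{good}}\subseteq\mathcal{F}$ in the poset $(\mathcal{F},\subseteq)$ such that $$\bigcap_{A\in\mathcal{C}_{\mathrm{bad}}}A\notin\mathcal{F},\qquad \bigcap_{A\in\mathcal{C}_{\mathrm{good}}}A\in\mathcal{F}.$$
   Context: Fix a topological space $X$ and $P\in X$. Sequences are indexed by $\mathbb{N}=\{1,2,3,\dots\}$. $(X,P)$ is Fréchet–Urysohn at $P$ if for every $A\subseteq X$ with $P\in\overline{A}$ there is a sequence $(a_n)_{n\in\mathbb{N}}$ of points of $A$ with $a_n\to P$. $X$ is $T_1$ at $P$ if for every $x\in X$ with $x\neq P$ there is an open neighborhood $U$ of $P$ with $x\notin U$. $P$ is non-isolated if every neighborhood of $P$ contains a point $x\ne P$. $\mathcal{S}_P$ is the set of all sequences $T=(T_n)_{n\in\mathbb{N}}$ in $X$ with $T_n\to P$. $\mathcal{D}_P$ is the set of all functions $f:X\to\mathbb{R}$ that are discontinuous at $P$. For $f\in\mathcal{D}_P$, $D(f)=\{T\in\mathcal{S}_P : f(T_n)\not\to f(P)\}$. A subset $A\subseteq\mathcal{S}_P$ is a test set if $A\cap D(f)\neq\emptyset$ for every $f\in\mathcal{D}_P$.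 $\mathcal{F}$ denotes the family of all test sets. A chain in $(\mathcal{F},\subseteq)$ is a subset of $\mathcal{F}$ that is totally ordered by inclusion; it is maximal if it is not properly contained in another chain of $\mathcal{F}$. *)

theory Defs
  imports "HOL-Analysis.Abstract_Limits"
begin

(* Sequences are indexed by nat starting at 0 instead of 1. *)

definition frechet_urysohn_at :: "'a topology \<Rightarrow> 'a \<Rightarrow> bool" where
  "frechet_urysohn_at X P \<longleftrightarrow>
     (\<forall>A \<subseteq> topspace X. P \<in> X closure_of A \<longrightarrow>
        (\<exists>a :: nat \<Rightarrow> 'a. (\<forall>n. a n \<in> A) \<and> limitin X a P sequentially))"

definition t1_at :: "'a topology \<Rightarrow> 'a \<Rightarrow> bool" where
  "t1_at X P \<longleftrightarrow>
     (\<forall>x \<in> topspace X. x \<noteq> P \<longrightarrow> (\<exists>U. openin X U \<and> P \<in> U \<and> x \<notin> U))"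

definition non_isolated :: "'a topology \<Rightarrow> 'a \<Rightarrow> bool" where
  "non_isolated X P \<longleftrightarrow> (\<forall>U. openin X U \<and> P \<in> U \<longrightarrow> (\<exists>x \<in> U. x \<noteq> P))"

(* "limitin" alone does not force the terms of the sequence to lie in the space. *)
definition seqs_to :: "'a topology \<Rightarrow> 'a \<Rightarrow> (nat \<Rightarrow> 'a) set" where
  "seqs_to X P = {T. (\<forall>n. T n \<in> topspace X) \<and> limitin X T P sequentially}"

(* A real function on the space is represented by a total function on the ambient
   type; its values outside "topspace X" affect neither its continuity at P nor
   "disc_seqs". *)
definition discont_at :: "'a topology \<Rightarrow> 'a \<Rightarrow> ('a \<Rightarrow> real) set" where
  "discont_at X P = {f. \<not> topcontinuous_at X euclideanreal f P}"

definition disc_seqs :: "'a topology \<Rightarrow> 'a \<Rightarrow> ('a \<Rightarrow> real) \<Rightarrow> (nat \<Rightarrow> 'a) set" where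
  "disc_seqs X P f = {T \<in> seqs_to X P. \<not> (\<lambda>n. f (T n)) \<longlonglongrightarrow> f P}"

definition test_sets :: "'a topology \<Rightarrow> 'a \<Rightarrow> (nat \<Rightarrow> 'a) set set" where
  "test_sets X P =
     {A. A \<subseteq> seqs_to X P \<and> (\<forall>f \<in> discont_at X P. A \<inter> disc_seqs X P f \<noteq> {})}"

end

(* A set of sequences is a test set iff every injective sequence converging to P inside X - {P}
   shares infinitely many values with one of its members. Hence a maximal family M of such
   sequences with pairwise almost disjoint ranges is a test set, and a minimal one: the indicator
   function of the range of T \<in> M is detected by no other member of M. A maximal chain through M
   therefore has intersection M. Replacing T by all its tails from index k on gives a decreasing
   sequence of test sets with intersection M - {T}, which is no test set. *)
theory Submission
  imports Defs "HOL-Library.Indicator_Function"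
begin

section \<open>Extending a chain to a maximal chain\<close>

lemma subset_chain_extends_maxchain:
  assumes "subset.chain \<A> \<C>"
  obtains \<D> where "subset.maxchain \<A> \<D>" "\<C> \<subseteq> \<D>"
proof -
  \<comment> \<open>Zorn's lemma is applied to the chains that contain \<open>\<C>\<close>. A
    maximal one is maximal among all chains, since every larger chain contains \<open>\<C>\<close>
    as well.\<close>
  define \<B> where "\<B> = {\<D>. subset.chain \<A> \<D> \<and> \<C> \<subseteq> \<D>}"
  have "\<exists>M\<in>\<B>. \<forall>D\<in>\<B>. M \<subseteq> D \<longrightarrow> D = M"
  proof (rule subset_Zorn_nonempty)
    show "\<B> \<noteq> {}"
      using assms by (auto simp: \<B>_def)
  next
    fix K assume "K \<noteq> {}" and K: "subset.chain \<B> K"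
    have "subset.chain \<A> (\<Union>K)"
      unfolding subset_chain_def
    proof (intro conjI ballI)
      show "\<Union>K \<subseteq> \<A>"
        using K by (auto simp: subset_chain_def \<B>_def)
    next
      fix x y assume "x \<in> \<Union>K" "y \<in> \<Union>K"
      then obtain D E where DE: "x \<in> D" "D \<in> K" "y \<in> E" "E \<in> K"
        by blast
      then have "D \<subseteq> E \<or> E \<subseteq> D" "subset.chain \<A> D" "subset.chain \<A> E"
        using K by (auto simp: subset_chain_def \<B>_def)
      with DE show "x \<subseteq> y \<or> y \<subseteq> x"
        unfolding subset_chain_def by blast
    qed
    moreover have "\<C> \<subseteq> \<Union>K"
    proof -
      obtain D where "D \<in> K"
        using \<open>K \<noteq> {}\<close> by blast
      moreover from this have "\<C> \<subseteq> D"
        using K by (auto simp: subset_chain_def \<B>_def)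
      ultimately show ?thesis
        by blast
    qed
    ultimately show "\<Union>K \<in> \<B>"
      by (simp add: \<B>_def)
  qed
  then obtain M where M: "M \<in> \<B>" "\<And>D. D \<in> \<B> \<Longrightarrow> M \<subseteq> D \<Longrightarrow> D = M"
    by blast
  then have "subset.maxchain \<A> M" "\<C> \<subseteq> M"
    unfolding subset.maxchain_def \<B>_def by blast+
  then show thesis
    by (rule that)
qed

section \<open>Injective sequences converging to P\<close>

definition inj_seqs_to :: "'a topology \<Rightarrow> 'a \<Rightarrow> (nat \<Rightarrow> 'a) set" where
  "inj_seqs_to X P = {T \<in> seqs_to X P. inj T \<and> P \<notin> range T}"


lemma tail_in_seqs_to:
  assumes "T \<in> seqs_to X P"
  shows "(\<lambda>i. T (i + k)) \<in> seqs_to X P"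
  using assms limitin_sequentially_offset[of X T P k] by (simp add: seqs_to_def)

lemma finite_range_diff_open:
  assumes "limitin X a P sequentially" "openin X U" "P \<in> U"
  shows "finite (range a - U)"
proof -
  obtain N where "\<And>n. N \<le> n \<Longrightarrow> a n \<in> U"
    using assms by (auto simp: limitin_sequentially)
  then have "range a - U \<subseteq> a ` {..<N}"
    using not_le by blast
  then show ?thesis
    by (rule finite_subset) simp
qed

text \<open>The order of the terms is immaterial, so \<open>S\<close> need not be a subsequence of
  \<open>a\<close>: a neighbourhood of P misses only finitely many values of \<open>a\<close>, and
  \<open>S\<close> takes each of them at most once.\<close>

lemma limitin_inj_seq:
  fixes S :: "nat \<Rightarrow> 'a"
  assumes a: "limitin X a P sequentially" and "inj S" "range S \<subseteq> range a"
  shows "limitin X S P sequentially"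
  unfolding limitin_def
proof (intro conjI allI impI)
  show "P \<in> topspace X"
    using a by (simp add: limitin_def)
next
  fix U assume "openin X U \<and> P \<in> U"
  then have "finite (range a - U)"
    by (intro finite_range_diff_open[OF a]) auto
  then have "finite (S -` (range a - U))"
    using \<open>inj S\<close> by (rule finite_vimageI)
  moreover have "{n. \<not> S n \<in> U} \<subseteq> S -` (range a - U)"
    using assms by auto
  ultimately show "\<forall>\<^sub>F n in sequentially. S n \<in> U"
    unfolding cofinite_eq_sequentially[symmetric] eventually_cofinite by (rule rev_finite_subset)
qed

text \<open>Otherwise some value x \<noteq> P is taken infinitely often, and a neighbourhood of P
  that omits x contradicts convergence.\<close>

lemma infinite_range_if_limitin:
  fixes a :: "nat \<Rightarrow> 'a"
  assumes t1: "t1_at X P" and a: "limitin X a P sequentially"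
    and "range a \<subseteq> topspace X" "P \<notin> range a"
  shows "infinite (range a)"
proof
  assume "finite (range a)"
  then obtain x where x: "x \<in> range a" "infinite {n. a n = x}"
    using pigeonhole_infinite[of "UNIV :: nat set" a] by auto
  then have "x \<in> topspace X" "x \<noteq> P"
    using assms by auto
  then obtain U where "openin X U" "P \<in> U" "x \<notin> U"
    using t1 unfolding t1_at_def by blast
  moreover from this have "finite {n. a n \<notin> U}"
    using a unfolding limitin_def cofinite_eq_sequentially[symmetric] eventually_cofinite by blast
  ultimately show False
    using x(2) finite_subset[of "{n. a n = x}" "{n. a n \<notin> U}"] by blast
qed

section \<open>A criterion for test sets\<close>

lemma discont_at_obtains_inj_seq:
  assumes "P \<in> topspace X" "frechet_urysohn_at X P" "t1_at X P" "f \<in> discont_at X P"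
  obtains S V where "S \<in> inj_seqs_to X P" "open V" "f P \<in> V" "\<And>n. f (S n) \<notin> V"
proof -
  obtain V where V: "open V" "f P \<in> V"
    and noU: "\<And>U. openin X U \<Longrightarrow> P \<in> U \<Longrightarrow> \<exists>y\<in>U. f y \<notin> V"
    using assms by (auto simp: discont_at_def topcontinuous_at_def)
  \<comment> \<open>No neighbourhood of P is mapped into \<open>V\<close>, so P lies in the closure
    of \<open>B\<close>, though not in \<open>B\<close>.\<close>
  define B where "B = {x \<in> topspace X. f x \<notin> V}"
  have "P \<in> X closure_of B"
    unfolding in_closure_of B_def using assms(1) noU openin_subset by fastforce
  moreover have "B \<subseteq> topspace X"
    by (auto simp: B_def)
  ultimately obtain a :: "nat \<Rightarrow> 'a" where a: "\<And>n. a n \<in> B" "limitin X a P sequentially"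
    using assms(2) unfolding frechet_urysohn_at_def by meson
  have "infinite (range a)"
    using a V assms by (intro infinite_range_if_limitin[of X P]) (auto simp: B_def)
  \<comment> \<open>The sequence \<open>a\<close> may repeat values. Any injective enumeration of
    infinitely many of them still converges to P, by \<open>limitin_inj_seq\<close>.\<close>
  then obtain S :: "nat \<Rightarrow> 'a" where S: "inj S" "range S \<subseteq> range a"
    using infinite_countable_subset by blast
  have "S n \<in> B" for n
    using a(1) S(2) by (metis rangeE range_subsetD)
  then have SB: "S n \<in> topspace X" "f (S n) \<notin> V" for n
    by (simp_all add: B_def)
  then have "P \<notin> range S"
    using V(2) by (metis rangeE)
  then have "S \<in> inj_seqs_to X P"
    using limitin_inj_seq[OF a(2) S] S(1) SB(1) by (simp add: inj_seqs_to_def seqs_to_def)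
  then show thesis
    using that V SB(2) by metis
qed

text \<open>If f(T n) tended to f(P), all but finitely many terms of \<open>T\<close> would be
  mapped into \<open>V\<close>. No value of \<open>S\<close> is, so the two ranges would share only
  finitely many points.\<close>

lemma test_setsI:
  assumes "P \<in> topspace X" "frechet_urysohn_at X P" "t1_at X P"
    and A: "A \<subseteq> seqs_to X P"
    and hit: "\<And>S. S \<in> inj_seqs_to X P \<Longrightarrow> \<exists>T\<in>A. infinite (range T \<inter> range S)"
  shows "A \<in> test_sets X P"
  unfolding test_sets_def
proof (intro CollectI conjI ballI A)
  fix f :: "'a \<Rightarrow> real" assume "f \<in> discont_at X P"
  then obtain S V where S: "S \<in> inj_seqs_to X P" "open V" "f P \<in> V" "\<And>n. f (S n) \<notin> V"
    using discont_at_obtains_inj_seq assms(1-3) by metis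
  obtain T where T: "T \<in> A" "infinite (range T \<inter> range S)"
    using hit S(1) by blast
  have "\<not> (\<lambda>n. f (T n)) \<longlonglongrightarrow> f P"
  proof
    assume "(\<lambda>n. f (T n)) \<longlonglongrightarrow> f P"
    then have "\<forall>\<^sub>F n in sequentially. f (T n) \<in> V"
      using S(2,3) by (rule topological_tendstoD)
    then obtain N where N: "\<And>n. n \<ge> N \<Longrightarrow> f (T n) \<in> V"
      by (auto simp: eventually_sequentially)
    have "range T \<inter> range S \<subseteq> T ` {..<N}"
    proof
      fix x assume "x \<in> range T \<inter> range S"
      then obtain n m where "x = T n" "x = S m"
        by blast
      then have "n < N"
        using N[of n] S(4)[of m] by (cases "n < N") auto
      with \<open>x = T n\<close> show "x \<in> T ` {..<N}"
        by simp
    qed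
    then show False
      using T(2) finite_subset by blast
  qed
  then show "A \<inter> disc_seqs X P f \<noteq> {}"
    using T(1) A by (auto simp: disc_seqs_def)
qed

section \<open>Indicator functions of ranges and minimality\<close>

lemma indicator_range_discont_at:
  assumes "T \<in> seqs_to X P" "P \<notin> range T"
  shows "(indicator (range T) :: 'a \<Rightarrow> real) \<in> discont_at X P"
proof -
  have False if "topcontinuous_at X euclideanreal (indicator (range T)) P"
  proof -
    \<comment> \<open>This open set contains the value 0 at P and excludes the value 1 taken at the
      terms of \<open>T\<close>, which enter every neighbourhood of P.\<close>
    have "openin euclideanreal {..<1}" "indicator (range T) P \<in> {..<1::real}"
      using assms(2) by auto
    with that have "\<exists>U. openin X U \<and> P \<in> U \<and> (\<forall>y\<in>U. indicator (range T) y \<in> {..<1::real})"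
      unfolding topcontinuous_at_def by fast
    then obtain U where U: "openin X U" "P \<in> U"
        "\<forall>y\<in>U. indicator (range T) y \<in> {..<1::real}"
      by blast
    then obtain n where "T n \<in> U"
      using assms(1) by (force simp: seqs_to_def limitin_sequentially)
    then show False
      using U(3) by fastforce
  qed
  then show ?thesis
    by (auto simp: discont_at_def)
qed

text \<open>Injectivity turns finitely many common values into finitely many indices.\<close>

lemma indicator_tendsto_0_if_almost_disjoint:
  fixes S :: "nat \<Rightarrow> 'a"
  assumes "inj S" "finite (range S \<inter> R)"
  shows "(\<lambda>n. indicator R (S n) :: real) \<longlonglongrightarrow> 0"
proof (rule tendsto_eventually)
  have "finite (S -` (range S \<inter> R))"
    using assms by (rule finite_vimageI[rotated])
  then have "\<forall>\<^sub>F n in sequentially. S n \<notin> R"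
    unfolding cofinite_eq_sequentially[symmetric] eventually_cofinite
    by (rule rev_finite_subset) auto
  then show "\<forall>\<^sub>F n in sequentially. (indicator R (S n) :: real) = 0"
    by eventually_elim simp
qed

text \<open>Distinct sequences are compared, not distinct ranges, so two different enumerations of
  one infinite set cannot both belong to \<open>M\<close>.\<close>

definition almost_disjoint :: "(nat \<Rightarrow> 'a) set \<Rightarrow> bool" where
  "almost_disjoint M \<longleftrightarrow> pairwise (\<lambda>S T. finite (range S \<inter> range T)) M"

text \<open>Serves both chains: it gives the minimality of \<open>M\<close> for the good one and
  rules out the intersection of the bad one.\<close>

lemma not_test_set_if_almost_disjoint_remove:
  assumes "M \<subseteq> inj_seqs_to X P" "almost_disjoint M" "T \<in> M" "A \<subseteq> M - {T}"
  shows "A \<notin> test_sets X P"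
proof
  assume "A \<in> test_sets X P"
  moreover have T: "T \<in> seqs_to X P" "P \<notin> range T"
    using assms by (auto simp: inj_seqs_to_def)
  ultimately obtain S where S: "S \<in> A" "S \<in> disc_seqs X P (indicator (range T))"
    using indicator_range_discont_at[OF T] unfolding test_sets_def by blast
  then have "inj S" "finite (range S \<inter> range T)"
    using assms unfolding almost_disjoint_def pairwise_def inj_seqs_to_def by blast+
  then have "(\<lambda>n. indicator (range T) (S n) :: real) \<longlonglongrightarrow> 0"
    by (rule indicator_tendsto_0_if_almost_disjoint)
  then show False
    using S(2) T(2) by (simp add: disc_seqs_def)
qed

section \<open>Maximal almost disjoint families\<close>

lemma maximal_almost_disjoint_exists:
  obtains M where "M \<subseteq> I" "almost_disjoint M"
    "\<And>S. S \<in> I \<Longrightarrow> infinite (range S) \<Longrightarrow> \<exists>T\<in>M. infinite (range T \<inter> range S)"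
proof -
  let ?\<A> = "{M. M \<subseteq> I \<and> almost_disjoint M}"
  have "\<exists>M\<in>?\<A>. \<forall>N\<in>?\<A>. M \<subseteq> N \<longrightarrow> N = M"
  proof (rule subset_Zorn')
    fix K assume "subset.chain ?\<A> K"
    then show "\<Union>K \<in> ?\<A>"
      unfolding almost_disjoint_def subset_chain_def
      by (auto intro!: pairwise_chain_Union simp: chain_subset_def)
  qed
  then obtain M where M: "M \<subseteq> I" "almost_disjoint M"
    and max: "\<And>N. N \<subseteq> I \<Longrightarrow> almost_disjoint N \<Longrightarrow> M \<subseteq> N \<Longrightarrow> N = M"
    by auto
  have "\<exists>T\<in>M. infinite (range T \<inter> range S)" if "S \<in> I" "infinite (range S)" for S
  proof (rule ccontr)
    assume fin: "\<not> ?thesis"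
    then have "almost_disjoint (insert S M)"
      using M(2) by (auto simp: almost_disjoint_def pairwise_insert Int_commute)
    then have "S \<in> M"
      using max[of "insert S M"] M(1) that(1) by blast
    \<comment> \<open>As a member of \<open>M\<close>, \<open>S\<close> meets itself in its own
      infinite range, contrary to \<open>fin\<close>.\<close>
    then show False
      using fin that(2) by auto
  qed
  then show thesis
    using that M by blast
qed

section \<open>Replacing a sequence by its tails\<close>

definition with_tails :: "(nat \<Rightarrow> 'a) set \<Rightarrow> (nat \<Rightarrow> 'a) \<Rightarrow> nat \<Rightarrow> (nat \<Rightarrow> 'a) set" where
  "with_tails M T k = (M - {T}) \<union> (\<lambda>m i. T (i + m)) ` {k..}"

text \<open>This is why all offsets from k on are kept: with the k-th tail alone, the sets for an
  injective \<open>T\<close> in an almost disjoint \<open>M\<close> would be pairwise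
  incomparable.\<close>

lemma with_tails_antimono:
  "k \<le> l \<Longrightarrow> with_tails M T l \<subseteq> with_tails M T k"
  by (auto simp: with_tails_def)

text \<open>Any other common member would be a tail of \<open>T\<close> for arbitrarily large
  offsets, but the first term of a tail of an injective sequence determines its offset.\<close>

lemma Inter_with_tails:
  assumes "inj T"
  shows "(\<Inter>k. with_tails M T k) \<subseteq> M - {T}"
proof
  fix U assume U: "U \<in> (\<Inter>k. with_tails M T k)"
  show "U \<in> M - {T}"
  proof (rule ccontr)
    assume no: "U \<notin> M - {T}"
    have "\<exists>m\<ge>k. U = (\<lambda>i. T (i + m))" for k
      using U no by (auto simp: with_tails_def)
    then obtain m m' where "U = (\<lambda>i. T (i + m))" "m' \<ge> Suc m" "U = (\<lambda>i. T (i + m'))"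
      by metis
    then have "T (0 + m) = T (0 + m')"
      by metis
    then show False
      using assms \<open>m' \<ge> Suc m\<close> by (auto dest: injD)
  qed
qed

section \<open>The two maximal chains\<close>

theorem theorem1p2:
  fixes X :: "'a topology" and P :: 'a
  assumes "P \<in> topspace X"
    and "frechet_urysohn_at X P"
    and "t1_at X P"
    and "non_isolated X P"
    and "\<exists>f :: 'a \<Rightarrow> real. f \<in> discont_at X P"
  shows "\<exists>C_bad C_good.
           subset.maxchain (test_sets X P) C_bad \<and>
           subset.maxchain (test_sets X P) C_good \<and>
           \<Inter> C_bad \<notin> test_sets X P \<and>
           \<Inter> C_good \<in> test_sets X P"
proof -
  let ?F = "test_sets X P"
  obtain M where M: "M \<subseteq> inj_seqs_to X P" "almost_disjoint M"
    and mad: "\<And>S. S \<in> inj_seqs_to X P \<Longrightarrow> infinite (range S)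
                \<Longrightarrow> \<exists>T\<in>M. infinite (range T \<inter> range S)"
    using maximal_almost_disjoint_exists by blast
  have hit: "\<exists>T\<in>M. infinite (range T \<inter> range S)" if "S \<in> inj_seqs_to X P" for S
    using that mad range_inj_infinite by (auto simp: inj_seqs_to_def)
  have M_seqs: "M \<subseteq> seqs_to X P"
    using M(1) by (auto simp: inj_seqs_to_def)
  then have MF: "M \<in> ?F"
    using hit by (rule test_setsI[OF assms(1-3)])
  \<comment> \<open>\<open>M\<close> is nonempty because it detects the given discontinuous
    function.\<close>
  then obtain T where T: "T \<in> M"
    using assms(5) by (auto simp: test_sets_def)

  obtain C_good where good: "subset.maxchain ?F C_good" "{M} \<subseteq> C_good"
    using subset_chain_extends_maxchain[of ?F "{M}"] MF by (auto simp: subset_chain_def)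
  \<comment> \<open>Each member of the chain is comparable with \<open>M\<close>, and none is
    properly smaller, since it would omit some member of \<open>M\<close>.\<close>
  have "M \<subseteq> A" if "A \<in> C_good" for A
  proof (rule ccontr)
    assume "\<not> M \<subseteq> A"
    moreover have A: "A \<in> ?F" "A \<subseteq> M \<or> M \<subseteq> A"
      using good that subset.maxchain_imp_chain[OF good(1)] by (auto simp: subset_chain_def)
    ultimately obtain S where "S \<in> M" "A \<subseteq> M - {S}"
      by blast
    then show False
      using not_test_set_if_almost_disjoint_remove[OF M] A(1) by blast
  qed
  then have "\<Inter>C_good = M"
    using good(2) by blast

  have "inj T" "T \<in> seqs_to X P"
    using T M(1) by (auto simp: inj_seqs_to_def)
  have tailsF: "with_tails M T k \<in> ?F" for k
  proof (rule test_setsI)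
    show "with_tails M T k \<subseteq> seqs_to X P"
      using M_seqs tail_in_seqs_to[OF \<open>T \<in> seqs_to X P\<close>] by (auto simp: with_tails_def)
  next
    fix S assume "S \<in> inj_seqs_to X P"
    then obtain U where U: "U \<in> M" "infinite (range U \<inter> range S)"
      using hit by blast
    show "\<exists>U\<in>with_tails M T k. infinite (range U \<inter> range S)"
    proof (cases "U = T")
      case True
      \<comment> \<open>Dropping the first k terms of \<open>T\<close> loses only finitely many
        values, so the tail still shares infinitely many with \<open>S\<close>.\<close>
      have "range T \<inter> range S \<subseteq> T ` {..<k} \<union> (range (\<lambda>i. T (i + k)) \<inter> range S)"
      proof
        fix x assume "x \<in> range T \<inter> range S"
        then obtain n where "x = T n" "x \<in> range S"
          by blast
        then show "x \<in> T ` {..<k} \<union> (range (\<lambda>i. T (i + k)) \<inter> range S)"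
          by (cases "n < k") (auto intro!: image_eqI[of _ _ "n - k"])
      qed
      then have "infinite (range (\<lambda>i. T (i + k)) \<inter> range S)"
        using U(2) True finite_subset by (metis finite_Un finite_imageI finite_lessThan)
      then show ?thesis
        by (auto simp: with_tails_def)
    qed (use U in \<open>auto simp: with_tails_def\<close>)
  qed (use assms in auto)
  have "subset.chain ?F (range (with_tails M T))"
    unfolding subset_chain_def
  proof (intro conjI ballI)
    show "range (with_tails M T) \<subseteq> ?F"
      using tailsF by blast
  next
    fix A B assume "A \<in> range (with_tails M T)" "B \<in> range (with_tails M T)"
    then obtain k l where "A = with_tails M T k" "B = with_tails M T l"
      by blast
    then show "A \<subseteq> B \<or> B \<subseteq> A"
      using with_tails_antimono[of k l M T] with_tails_antimono[of l k M T] nat_le_linear[of k l] by auto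
  qed
  then obtain C_bad where bad: "subset.maxchain ?F C_bad" "range (with_tails M T) \<subseteq> C_bad"
    by (rule subset_chain_extends_maxchain)
  \<comment> \<open>Further members of \<open>C_bad\<close> can only shrink the intersection, and no
    subset of \<open>M - {T}\<close> is a test set.\<close>
  from Inter_anti_mono[OF bad(2)] have "\<Inter>C_bad \<subseteq> M - {T}"
    using Inter_with_tails[OF \<open>inj T\<close>] by (rule subset_trans)
  then have "\<Inter>C_bad \<notin> ?F"
    by (rule not_test_set_if_almost_disjoint_remove[OF M T])
  moreover have "\<Inter>C_good \<in> ?F"
    using MF \<open>\<Inter>C_good = M\<close> by simp
  ultimately show ?thesis
    using bad(1) good(1) by (intro exI conjI)
qed

end
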